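(* Let $D$ be a mixed graph of order $n$ whose $H$-rank is equal to $2$ and let $\rho$ be its positive $H$-eigenvalue. Then $D$ is switching equivalent either to (a mixed graph isomorphic to) $K_{a,b}\cup tK_1$ for some integers $1\le a\le b$ and $t\ge 0$, or to (a mixed graph isomorphic to) $\vec{C}_3(a,b,c)\cup tK_1$ for some integers $1\le a\le b\le c$ and $t\ge 0$. In the former case we have $$n=a+b+t\quad\text{and}\quad \rho^2=ab,$$ and in the latter case $$n=a+b+c+t\quad\text{and}\quad \rho^2=ab+bc+ac.$$ Conversely, for any integers $t\ge 0$ and $1\le a\le b\le c$, the mixed graphs $K_{a,b}\cup tK_1$ and $\vec{C}_3(a,b,c)\cup tK_1$ have $H$-rank $2$, and, with $n$ denoting the order and $\rho$ the positive $H$-eigenvalue of the mixed graph in question, they satisfy $n=a+b+t$, $\rho^2=ab$ and $n=a+b+c+t$, $\rho^2=ab+bc+ac$, respectively.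
   Context: A mixed graph $D$ is obtained from a finite simple undirected graph (its underlying graph $G(D)$) by orienting a subset of its edges; so each edge of $G(D)$ is in $D$ either an undirected edge or an arc in exactly one direction. Its Hermitian adjacency matrix $H(D)\in\mathbb{C}^{V\times V}$, $V=V(D)$, has $(u,v)$-entry $1$ if $uv$ is an undirected edge, $i$ (imaginary unit) if there is an arc from $u$ to $v$, $-i$ if there is an arc from $v$ to $u$, and $0$ otherwise. The eigenvalues of this Hermitian matrix are the $H$-eigenvalues of $D$, and its rank is the $H$-rank of $D$. (Since the trace of $H(D)$ is $0$, a mixed graph of $H$-rank $2$ has exactly one positive $H$-eigenvalue.) Let $\mathcal{S}$ be the set of diagonal matrices indexed by $V$ with all diagonal entries in $\{1,-1,i,-i\}$. A mixed graph $D'$ on the vertex set $V(D)$ is obtained from $D$ by a four-way switching if $H(D')=S^{-1}H(D)S$ for some $S\in\mathcal{S}$. The converse $D^T$ is obtained from $D$ by reversing all arcs. Two mixed graphs are switching equivalent if one can be obtained from the other by a finite sequence of four-way switchings and operations of taking the converse. $K_{a,b}$ is the (undirected) complete bipartite graph with parts of size $a$ and $b$. For positive integers $a\le b\le c$, $\vec{C}_3(a,b,c)$ is the complete tripartite mixed graph with parts $A,B,C$, $|A|=a$, $|B|=b$, $|C|=c$, having all arcs from $A$ to $B$, all arcs from $B$ to $C$, and all arcs from $C$ to $A$ (and no other edges). $X\cup tK_1$ denotes $X$ together with $t$ additional isolated vertices. *)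

theory Defs
  imports Complex_Main "HOL-Library.Function_Algebras"
begin

text \<open>Undirected edges are two-element vertex sets, and \<open>(u, v) \<in> arcs D\<close> is an arc from \<open>u\<close> to \<open>v\<close>.\<close>

record 'a mgraph =
  verts :: "'a set"
  edges :: "'a set set"
  arcs :: "('a \<times> 'a) set"

definition mixed_graph :: "'a mgraph \<Rightarrow> bool" where
  "mixed_graph D \<longleftrightarrow>
     finite (verts D) \<and>
     edges D \<subseteq> {{u, v} | u v. u \<in> verts D \<and> v \<in> verts D \<and> u \<noteq> v} \<and>
     arcs D \<subseteq> {(u, v). u \<in> verts D \<and> v \<in> verts D \<and> u \<noteq> v} \<and>
     (\<forall>u v. (u, v) \<in> arcs D \<longrightarrow> (v, u) \<notin> arcs D \<and> {u, v} \<notin> edges D)"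

definition order :: "'a mgraph \<Rightarrow> nat" where
  "order D = card (verts D)"

definition mgraph_iso :: "'a mgraph \<Rightarrow> 'b mgraph \<Rightarrow> bool" where
  "mgraph_iso D E \<longleftrightarrow>
     (\<exists>f. bij_betw f (verts D) (verts E) \<and>
        (\<forall>u\<in>verts D. \<forall>v\<in>verts D.
           ({u, v} \<in> edges D \<longleftrightarrow> {f u, f v} \<in> edges E) \<and>
           ((u, v) \<in> arcs D \<longleftrightarrow> (f u, f v) \<in> arcs E)))"


text \<open>The \<open>V \<times> V\<close> matrix is a function of two vertices; for a mixed graph it vanishes outside \<open>V \<times> V\<close>.\<close>

definition herm_adj :: "'a mgraph \<Rightarrow> 'a \<Rightarrow> 'a \<Rightarrow> complex" where
  "herm_adj D u v =
     (if {u, v} \<in> edges D then 1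
      else if (u, v) \<in> arcs D then \<i>
      else if (v, u) \<in> arcs D then - \<i>
      else 0)"

definition H_eigenvalue :: "'a mgraph \<Rightarrow> complex \<Rightarrow> bool" where
  "H_eigenvalue D k \<longleftrightarrow>
     (\<exists>x. (\<exists>v\<in>verts D. x v \<noteq> 0) \<and>
        (\<forall>u\<in>verts D. (\<Sum>v\<in>verts D. herm_adj D u v * x v) = k * x u))"

definition fun_scale :: "complex \<Rightarrow> ('a \<Rightarrow> complex) \<Rightarrow> 'a \<Rightarrow> complex" where
  "fun_scale c f = (\<lambda>v. c * f v)"

lemma vector_space_fun_scale: "vector_space fun_scale"
  by unfold_locales (auto simp: fun_scale_def fun_eq_iff algebra_simps)

text \<open>The rank is the dimension of the span of the columns, inside the space of all functions
  on the vertex type; this is the column space in \<open>\<complex>\<^sup>V\<close>, since the columns vanish outside \<open>V\<close>.\<close>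

definition H_rank :: "'a mgraph \<Rightarrow> nat" where
  "H_rank D = vector_space.dim fun_scale ((\<lambda>v u. herm_adj D u v) ` verts D)"

definition is_the_positive_H_eigenvalue :: "'a mgraph \<Rightarrow> real \<Rightarrow> bool" where
  "is_the_positive_H_eigenvalue D \<rho> \<longleftrightarrow>
     0 < \<rho> \<and> H_eigenvalue D (complex_of_real \<rho>) \<and>
     (\<forall>\<mu>. 0 < \<mu> \<and> H_eigenvalue D (complex_of_real \<mu>) \<longrightarrow> \<mu> = \<rho>)"


text \<open>The function \<open>s\<close> lists the diagonal of \<open>S\<close>, so the right-hand side of the equation is the
  \<open>(u, v)\<close>-entry of \<open>S\<^sup>-\<^sup>1 H(D) S\<close>.\<close>

definition four_way_switching :: "'a mgraph \<Rightarrow> 'a mgraph \<Rightarrow> bool" where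
  "four_way_switching D D' \<longleftrightarrow>
     verts D' = verts D \<and>
     (\<exists>s. (\<forall>v\<in>verts D. s v \<in> {1, - 1, \<i>, - \<i>}) \<and>
        (\<forall>u\<in>verts D. \<forall>v\<in>verts D.
           herm_adj D' u v = inverse (s u) * herm_adj D u v * s v))"

definition converse_mgraph :: "'a mgraph \<Rightarrow> 'a mgraph" where
  "converse_mgraph D = D\<lparr>arcs := (arcs D)\<inverse>\<rparr>"

definition switching_step :: "'a mgraph \<Rightarrow> 'a mgraph \<Rightarrow> bool" where
  "switching_step D D' \<longleftrightarrow>
     mixed_graph D \<and> mixed_graph D' \<and>
     (four_way_switching D D' \<or> D' = converse_mgraph D)"

text \<open>Each step is reversible, so this relation is symmetric.\<close>

definition switching_equivalent :: "'a mgraph \<Rightarrow> 'a mgraph \<Rightarrow> bool" where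
  "switching_equivalent = switching_step\<^sup>*\<^sup>*"

definition switching_equivalent_to_copy :: "'a mgraph \<Rightarrow> 'b mgraph \<Rightarrow> bool" where
  "switching_equivalent_to_copy D X \<longleftrightarrow>
     (\<exists>D'. switching_equivalent D D' \<and> mgraph_iso D' X)"


definition complete_bipartite :: "nat \<Rightarrow> nat \<Rightarrow> nat mgraph" where
  "complete_bipartite a b =
     \<lparr>verts = {..<a + b},
      edges = {{u, v} | u v. u \<in> {..<a} \<and> v \<in> {a..<a + b}},
      arcs = {}\<rparr>"

definition C3 :: "nat \<Rightarrow> nat \<Rightarrow> nat \<Rightarrow> nat mgraph" where
  "C3 a b c =
     (let A = {..<a}; B = {a..<a + b}; C = {a + b..<a + b + c}
      in \<lparr>verts = A \<union> B \<union> C,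
          edges = {},
          arcs = A \<times> B \<union> B \<times> C \<union> C \<times> A\<rparr>)"

definition add_isolated :: "'a mgraph \<Rightarrow> nat \<Rightarrow> ('a + nat) mgraph" where
  "add_isolated X t =
     \<lparr>verts = Inl ` verts X \<union> Inr ` {..<t},
      edges = (\<lambda>e. Inl ` e) ` edges X,
      arcs = map_prod Inl Inl ` arcs X\<rparr>"

end

(* Let p and q be adjacent in a mixed graph of rank 2. Their columns span the column space, and
   reading off the rows p and q gives H(u,v) = a(u) cnj b(v) + b(u) cnj a(v), where a is the column
   of p, b is a unit multiple of the column of q, and all their values are 0 or fourth roots of
   unity. A four-way switching normalises every pair (a(u), b(u)) to one of (0,0), (1,0), (0,1),
   (1,i), (1,-i): the zero diagonal makes a(u) cnj b(u) imaginary. As entries have modulus at most 1,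
   the last two types exclude each other. So H is a blow-up of a single edge or of a triangle of
   weight i or -i, and further switchings and a converse bring it to the standard form with sorted
   classes. Order, real eigenvalues and the existence of a triangle are invariant. *)
theory Submission imports Defs begin

subsection \<open>Rank of the Hermitian adjacency matrix\<close>

text \<open>A four-way switching keeps the product of the entries around a triangle, and the
  converse conjugates it. The Hermitian matrix of a triangle with entries \<alpha>, \<beta>,
  \<gamma> has determinant \<alpha> \<beta> \<gamma> plus its conjugate, so rank 2 forces an
  imaginary product. This is why the triangle in the theorem is a directed one. The locale
  \<open>tri_blowup\<close> keeps the weights as parameters and allows an empty third class, so
  rank, eigenvalue and isomorphism are treated once for both families. Renaming the classes already
  settles the direction of the triangle, but it can only rotate them. Sorting by size may need the
  opposite cyclic order, and there the converse enters. The formulas are claimed for every choice of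
  parameters whose model has a copy equivalent to \<open>D\<close>, not only for the choice that is
  constructed. Hence order and eigenvalue are carried from an arbitrary model to \<open>D\<close>.
  Only real eigenvalues are compared, since the converse conjugates the matrix.\<close>

interpretation fs: vector_space fun_scale
  by (rule vector_space_fun_scale)

lemma herm_adj_cnj:
  assumes "mixed_graph D"
  shows "herm_adj D v u = cnj (herm_adj D u v)"
  using assms unfolding mixed_graph_def herm_adj_def by (auto simp: insert_commute)

lemma herm_adj_diag:
  assumes "mixed_graph D"
  shows "herm_adj D u u = 0"
  using assms unfolding mixed_graph_def herm_adj_def by (auto simp: doubleton_eq_iff)

lemma herm_adj_outside:
  assumes "mixed_graph D" "u \<notin> verts D \<or> v \<notin> verts D"
  shows "herm_adj D u v = 0"
  using assms unfolding mixed_graph_def herm_adj_def by (auto simp: doubleton_eq_iff)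

lemma herm_adj_values: "herm_adj D u v \<in> {0, 1, \<i>, - \<i>}"
  by (simp add: herm_adj_def)

lemma edges_iff_herm_adj: "{u, v} \<in> edges D \<longleftrightarrow> herm_adj D u v = 1"
  by (auto simp: herm_adj_def complex_eq_iff)

lemma arcs_iff_herm_adj:
  assumes "mixed_graph D"
  shows "(u, v) \<in> arcs D \<longleftrightarrow> herm_adj D u v = \<i>"
  using assms unfolding mixed_graph_def herm_adj_def by (auto simp: complex_eq_iff)

text \<open>The zero diagonal separates the columns: in row \<open>q\<close> every multiple of the
  column of \<open>q\<close> vanishes, while the column of \<open>p\<close> does not.\<close>

lemma columns_independent:
  fixes p q :: 'a
  assumes "H p p = 0" "H q q = 0" "H p q \<noteq> 0" "H q p \<noteq> 0"
  shows "fs.independent {\<lambda>u. H u p, \<lambda>u. H u q}" "(\<lambda>u. H u p) \<noteq> (\<lambda>u. H u q)"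
proof -
  show ne: "(\<lambda>u. H u p) \<noteq> (\<lambda>u. H u q)"
    using assms by metis
  have "(\<lambda>u. H u q) \<noteq> 0"
    using assms by (metis zero_fun_apply)
  moreover have "(\<lambda>u. H u p) \<notin> fs.span {\<lambda>u. H u q}"
  proof
    assume "(\<lambda>u. H u p) \<in> fs.span {\<lambda>u. H u q}"
    then obtain k where "(\<lambda>u. H u p) = fun_scale k (\<lambda>u. H u q)"
      by (auto simp: fs.span_singleton)
    then have "H q p = k * H q q"
      by (metis fun_scale_def)
    with assms show False by simp
  qed
  ultimately show "fs.independent {\<lambda>u. H u p, \<lambda>u. H u q}"
    using ne by (simp add: fs.independent_insert)
qed

lemma in_span_pair_iff:
  "f \<in> fs.span {g, h} \<longleftrightarrow> (\<exists>l m. \<forall>y. f y = l * g y + m * h y)"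
proof -
  have "f \<in> fs.span {g, h} \<longleftrightarrow> (\<exists>l m. f - fun_scale l g = fun_scale m h)"
    by (auto simp: fs.span_insert[of g "{h}"] fs.span_singleton)
  also have "\<dots> \<longleftrightarrow> (\<exists>l m. \<forall>y. f y = l * g y + m * h y)"
    by (simp add: fun_eq_iff fun_scale_def algebra_simps)
  finally show ?thesis .
qed

text \<open>Columns of adjacent vertices are independent, so rank 2 means that they form a basis of
  the column space. One direction supplies coefficients for the factorization of \<open>D\<close>,
  the other proves the rank of the models.\<close>

lemma H_rank_2_iff:
  assumes "mixed_graph D" "p \<in> verts D" "q \<in> verts D" "herm_adj D p q \<noteq> 0"
  shows "H_rank D = 2 \<longleftrightarrow>
    (\<forall>x\<in>verts D. \<exists>l m. \<forall>y. herm_adj D y x = l * herm_adj D y p + m * herm_adj D y q)"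
proof -
  let ?c = "\<lambda>v u. herm_adj D u v"
  have "herm_adj D q p \<noteq> 0"
    using assms herm_adj_cnj[of D p q] by simp
  then have ind: "fs.independent {?c p, ?c q}" and ne: "?c p \<noteq> ?c q"
    using columns_independent[of "herm_adj D" p q] assms by (simp_all add: herm_adj_diag)
  have fin: "finite (verts D)"
    using assms by (simp add: mixed_graph_def)
  have "H_rank D = 2 \<longleftrightarrow> ?c ` verts D \<subseteq> fs.span {?c p, ?c q}"
  proof
    assume sub: "?c ` verts D \<subseteq> fs.span {?c p, ?c q}"
    have "fs.dim (?c ` verts D) = card {?c p, ?c q}"
      by (rule fs.dim_unique[OF _ sub ind]) (use assms in auto)
    then show "H_rank D = 2"
      using ne by (simp add: H_rank_def)
  next
    assume r: "H_rank D = 2"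
    \<comment> \<open>The pair is extended to a basis among the columns. As the rank is 2, nothing
      can have been added.\<close>
    obtain B where B: "{?c p, ?c q} \<subseteq> B" "B \<subseteq> ?c ` verts D" "fs.independent B"
      "?c ` verts D \<subseteq> fs.span B"
      using fs.maximal_independent_subset_extend[of "{?c p, ?c q}" "?c ` verts D"] ind assms by auto
    have "card B = 2"
      using fs.dim_unique[OF B(2,4,3), of "card B"] r by (simp add: H_rank_def)
    moreover have "finite B"
      using B(2) fin finite_surj by blast
    ultimately have "B = {?c p, ?c q}"
      using B(1) ne by (intro card_seteq[symmetric]) auto
    with B(4) show "?c ` verts D \<subseteq> fs.span {?c p, ?c q}" by simp
  qed
  then show ?thesis
    by (simp add: image_subset_iff in_span_pair_iff)
qed

text \<open>Used in contrapositive form: rank 2 provides an adjacent pair to start from.\<close>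

lemma H_rank_edgeless:
  assumes "\<forall>u v. herm_adj D u v = 0"
  shows "H_rank D = 0"
proof -
  have "(\<lambda>v u. herm_adj D u v) ` verts D \<subseteq> {0}"
    using assms by (auto simp: fun_eq_iff)
  then have "fs.dim ((\<lambda>v u. herm_adj D u v) ` verts D) = card ({} :: ('a \<Rightarrow> complex) set)"
    by (intro fs.dim_unique[of "{}"]) (auto simp: fs.independent_empty)
  then show ?thesis
    by (simp add: H_rank_def)
qed

subsection \<open>Blown-up triangles\<close>

text \<open>The class \<open>C\<close> may be empty, so that complete bipartite graphs are covered as well.\<close>

definition tri_mat ::
  "complex \<Rightarrow> complex \<Rightarrow> complex \<Rightarrow> 'a set \<Rightarrow> 'a set \<Rightarrow> 'a set \<Rightarrow> 'a \<Rightarrow> 'a \<Rightarrow> complex" where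
  "tri_mat \<alpha> \<beta> \<gamma> A B C u v =
     (if u \<in> A \<and> v \<in> B then \<alpha> else if u \<in> B \<and> v \<in> A then cnj \<alpha>
      else if u \<in> B \<and> v \<in> C then \<beta> else if u \<in> C \<and> v \<in> B then cnj \<beta>
      else if u \<in> C \<and> v \<in> A then \<gamma> else if u \<in> A \<and> v \<in> C then cnj \<gamma>
      else 0)"

text \<open>The quotient matrix of a blown-up triangle of imaginary weight has characteristic polynomial
  \<open>k\<^sup>3 - (a b + b c + a c) k\<close>.\<close>

lemma cyclic_system:
  fixes k \<alpha> \<alpha>' \<beta> \<beta>' \<gamma> \<gamma>' a b c u v w :: complex
  assumes unit: "\<alpha> * \<alpha>' = 1" "\<beta> * \<beta>' = 1" "\<gamma> * \<gamma>' = 1"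
    and imag: "\<alpha> * \<beta> * \<gamma> + \<alpha>' * \<beta>' * \<gamma>' = 0"
    and u: "k * u = \<alpha> * (b * v) + \<gamma>' * (c * w)"
    and v: "k * v = \<alpha>' * (a * u) + \<beta> * (c * w)"
    and w: "k * w = \<gamma> * (a * u) + \<beta>' * (b * v)"
  shows "k * k * (k * u) = (a * b + b * c + a * c) * (k * u)"
proof -
  \<comment> \<open>The expression that multiplies \<open>b * c\<close> when the equations for
    \<open>v\<close> and \<open>w\<close> are substituted into \<open>k * (k * u)\<close>.
    Multiplied by \<open>k\<close> it becomes \<open>k * u\<close>, because \<open>imag\<close>
    cancels the terms in \<open>a\<close>.\<close>
  let ?e = "\<alpha> * \<beta> * w + \<gamma>' * \<beta>' * v"
  have "k * ?e = \<alpha> * \<beta> * (k * w) + \<gamma>' * \<beta>' * (k * v)"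
    by (simp add: algebra_simps)
  also have "\<dots> = (\<alpha> * \<beta> * \<gamma> + \<alpha>' * \<beta>' * \<gamma>') * a * u
      + (\<beta> * \<beta>') * (\<alpha> * (b * v) + \<gamma>' * (c * w))"
    by (simp only: v w) (simp add: algebra_simps)
  also have "\<dots> = k * u"
    by (simp only: unit imag u) simp
  finally have e: "k * ?e = k * u" .
  have "k * (k * u) = \<alpha> * b * (k * v) + \<gamma>' * c * (k * w)"
    unfolding u by (simp add: algebra_simps)
  also have "\<dots> = (\<alpha> * \<alpha>') * a * b * u + (\<gamma> * \<gamma>') * a * c * u + b * c * ?e"
    by (simp only: v w) (simp add: algebra_simps)
  finally have "k * (k * u) = (a * b + a * c) * u + b * c * ?e"
    by (simp add: unit algebra_simps)
  then have "k * (k * (k * u)) = (a * b + a * c) * (k * u) + b * c * (k * ?e)"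
    by (simp add: algebra_simps)
  then show ?thesis
    unfolding e by (simp add: algebra_simps)
qed

text \<open>The left side of \<open>imag\<close> is the determinant of a single triangle with one
  vertex per class. The nonempty classes \<open>A\<close> and \<open>B\<close> guarantee an
  edge.\<close>

locale tri_blowup =
  fixes D :: "'a mgraph" and A B C :: "'a set" and \<alpha> \<beta> \<gamma> :: complex
  assumes mixed: "mixed_graph D"
    and sub: "A \<subseteq> verts D" "B \<subseteq> verts D" "C \<subseteq> verts D"
    and disj: "A \<inter> B = {}" "B \<inter> C = {}" "A \<inter> C = {}"
    and ne: "A \<noteq> {}" "B \<noteq> {}"
    and herm: "herm_adj D = tri_mat \<alpha> \<beta> \<gamma> A B C"
    and unit: "\<alpha> * cnj \<alpha> = 1" "\<beta> * cnj \<beta> = 1" "\<gamma> * cnj \<gamma> = 1"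
    and imag: "\<alpha> * \<beta> * \<gamma> + cnj \<alpha> * cnj \<beta> * cnj \<gamma> = 0"
begin

lemma fin: "finite (verts D)" "finite A" "finite B" "finite C"
  using mixed sub finite_subset by (auto simp: mixed_graph_def)

lemma notin:
  "x \<in> A \<Longrightarrow> x \<notin> B \<and> x \<notin> C" "x \<in> B \<Longrightarrow> x \<notin> A \<and> x \<notin> C" "x \<in> C \<Longrightarrow> x \<notin> A \<and> x \<notin> B"
  using disj by auto

lemma rank: "H_rank D = 2"
proof -
  obtain p q where p: "p \<in> A" and q: "q \<in> B"
    using ne by auto
  have pq: "herm_adj D p q \<noteq> 0"
    using p q unit by (auto simp: herm tri_mat_def)
  have "\<exists>l m. \<forall>y. herm_adj D y x = l * herm_adj D y p + m * herm_adj D y q" for x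
  proof -
    consider "x \<in> A" | "x \<in> B" | "x \<in> C" | "x \<notin> A \<union> B \<union> C" by auto
    then show ?thesis
    proof cases
      case 1
      then show ?thesis
        using p notin(1)[OF p] notin(1)[OF 1]
        by (intro exI[of _ 1] exI[of _ 0]) (simp add: herm tri_mat_def)
    next
      case 2
      then show ?thesis
        using q notin(2)[OF q] notin(2)[OF 2]
        by (intro exI[of _ 0] exI[of _ 1]) (simp add: herm tri_mat_def)
    next
      case 3
      \<comment> \<open>Row \<open>q\<close> dictates the first coefficient and row \<open>p\<close>
        the second. In the rows of \<open>C\<close> the combination must vanish, which is exactly
        \<open>imag\<close>.\<close>
      have "herm_adj D y x = \<alpha> * \<beta> * herm_adj D y p + cnj \<alpha> * cnj \<gamma> * herm_adj D y q" for y
        using 3 p q unit imag by (auto simp: herm tri_mat_def algebra_simps dest: notin)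
      then show ?thesis by blast
    next
      case 4
      then show ?thesis
        by (intro exI[of _ 0]) (simp add: herm tri_mat_def)
    qed
  qed
  then show ?thesis
    using H_rank_2_iff[OF mixed _ _ pq] p q sub by blast
qed

text \<open>A vector enters each row only through its three class sums, which reduces the eigenvalue
  equation to a system of size 3.\<close>

lemma row_sum:
  fixes x :: "'a \<Rightarrow> complex"
  shows "(\<Sum>v\<in>verts D. herm_adj D u v * x v) =
    (if u \<in> A then \<alpha> * sum x B + cnj \<gamma> * sum x C
     else if u \<in> B then cnj \<alpha> * sum x A + \<beta> * sum x C
     else if u \<in> C then \<gamma> * sum x A + cnj \<beta> * sum x B else 0)"
proof -
  have "(\<Sum>v\<in>verts D. herm_adj D u v * x v) = (\<Sum>v\<in>A \<union> B \<union> C. herm_adj D u v * x v)"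
    using sub fin by (intro sum.mono_neutral_right) (auto simp: herm tri_mat_def)
  also have "\<dots> = (\<Sum>v\<in>A. herm_adj D u v * x v) + (\<Sum>v\<in>B. herm_adj D u v * x v)
      + (\<Sum>v\<in>C. herm_adj D u v * x v)"
    using fin disj by (simp add: sum.union_disjoint Int_Un_distrib2)
  also have "(\<Sum>v\<in>A. herm_adj D u v * x v) =
      (\<Sum>v\<in>A. (if u \<in> B then cnj \<alpha> else if u \<in> C then \<gamma> else 0) * x v)"
    by (intro sum.cong) (auto simp: herm tri_mat_def dest: notin)
  also have "(\<Sum>v\<in>B. herm_adj D u v * x v) =
      (\<Sum>v\<in>B. (if u \<in> A then \<alpha> else if u \<in> C then cnj \<beta> else 0) * x v)"
    by (intro sum.cong) (auto simp: herm tri_mat_def dest: notin)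
  also have "(\<Sum>v\<in>C. herm_adj D u v * x v) =
      (\<Sum>v\<in>C. (if u \<in> B then \<beta> else if u \<in> A then cnj \<gamma> else 0) * x v)"
    by (intro sum.cong) (auto simp: herm tri_mat_def dest: notin)
  finally show ?thesis
    by (auto simp: sum_distrib_left[symmetric] dest: notin)
qed

section \<open>The nonzero eigenvalues of a blown-up triangle\<close>

definition weight :: nat where
  "weight = card A * card B + card B * card C + card A * card C"

lemma eigenvalue_weight:
  assumes "H_eigenvalue D k" "k \<noteq> 0"
  shows "k\<^sup>2 = of_nat weight"
proof -
  obtain x where nz: "\<exists>v\<in>verts D. x v \<noteq> 0"
    and ev: "\<And>u. u \<in> verts D \<Longrightarrow> (\<Sum>v\<in>verts D. herm_adj D u v * x v) = k * x u"
    using assms(1) by (auto simp: H_eigenvalue_def)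
  define a b c X Y Z where "a = (of_nat (card A) :: complex)" and "b = (of_nat (card B) :: complex)"
    and "c = (of_nat (card C) :: complex)"
    and XYZ: "X = sum x A" "Y = sum x B" "Z = sum x C"
  have kA: "k * x u = \<alpha> * Y + cnj \<gamma> * Z" if "u \<in> A" for u
    using ev[of u] that sub by (auto simp: row_sum XYZ)
  have kB: "k * x u = cnj \<alpha> * X + \<beta> * Z" if "u \<in> B" for u
    using ev[of u] that sub notin(2)[OF that] by (auto simp: row_sum XYZ)
  have kC: "k * x u = \<gamma> * X + cnj \<beta> * Y" if "u \<in> C" for u
    using ev[of u] that sub notin(3)[OF that] by (auto simp: row_sum XYZ)
  have kT: "k * x u = 0" if "u \<in> verts D" "u \<notin> A \<union> B \<union> C" for u
    using ev[of u] that by (simp add: row_sum)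
  have X: "k * X = a * (\<alpha> * Y + cnj \<gamma> * Z)"
    using sum.cong[OF refl kA] by (simp add: XYZ a_def sum_distrib_left[of k])
  have Y: "k * Y = b * (cnj \<alpha> * X + \<beta> * Z)"
    using sum.cong[OF refl kB] by (simp add: XYZ b_def sum_distrib_left[of k])
  have Z: "k * Z = c * (\<gamma> * X + cnj \<beta> * Y)"
    using sum.cong[OF refl kC] by (simp add: XYZ c_def sum_distrib_left[of k])
  \<comment> \<open>These are \<open>k\<close> times the common entries of the eigenvector on the
    three classes. Unlike those entries they make sense for an empty class.\<close>
  define U V W where UVW: "U = \<alpha> * Y + cnj \<gamma> * Z" "V = cnj \<alpha> * X + \<beta> * Z"
    "W = \<gamma> * X + cnj \<beta> * Y"
  have kU: "k * U = \<alpha> * (b * V) + cnj \<gamma> * (c * W)"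
    and kV: "k * V = cnj \<alpha> * (a * U) + \<beta> * (c * W)"
    and kW: "k * W = \<gamma> * (a * U) + cnj \<beta> * (b * V)"
    by (simp_all only: X[folded UVW, symmetric] Y[folded UVW, symmetric] Z[folded UVW, symmetric])
      (simp_all add: UVW algebra_simps)
  define s where "s = a * b + b * c + a * c"
  have U3: "k * k * (k * U) = s * (k * U)"
    using cyclic_system[OF unit imag kU kV kW] by (simp add: s_def)
  \<comment> \<open>\<open>cyclic_system\<close> speaks of its first unknown only, and that one may
    be zero. The system is invariant under cyclic rotation, so the same holds for the other
    two.\<close>
  have V3: "k * k * (k * V) = s * (k * V)"
    using cyclic_system[OF unit(2,3,1) _ kV[unfolded add.commute[of "cnj \<alpha> * _"]]
        kW[unfolded add.commute[of "\<gamma> * _"]] kU] imag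
    by (simp add: s_def ac_simps)
  have W3: "k * k * (k * W) = s * (k * W)"
    using cyclic_system[OF unit(3,1,2) _ kW kU[unfolded add.commute[of "\<alpha> * _"]]
        kV[unfolded add.commute[of "cnj \<alpha> * _"]]] imag
    by (simp add: s_def ac_simps)
  have "U \<noteq> 0 \<or> V \<noteq> 0 \<or> W \<noteq> 0"
  proof (rule ccontr)
    assume "\<not> ?thesis"
    then have "x u = 0" if "u \<in> verts D" for u
      using kA[of u] kB[of u] kC[of u] kT[of u] that assms(2) by (auto simp: UVW)
    with nz show False by auto
  qed
  then have "k * k = s"
    using U3 V3 W3 assms(2) by auto
  then have "k\<^sup>2 = s"
    by (simp add: power2_eq_square)
  then show ?thesis
    by (simp add: s_def weight_def a_def b_def c_def)
qed

lemma weight_eigenvalue: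
  fixes r :: real
  assumes "r > 0" "r\<^sup>2 = weight"
  shows "H_eigenvalue D r"
proof -
  define a b c k where "a = (of_nat (card A) :: complex)" and "b = (of_nat (card B) :: complex)"
    and "c = (of_nat (card C) :: complex)" and "k = complex_of_real r"
  have k2: "k\<^sup>2 = a * b + b * c + a * c"
    using arg_cong[OF assms(2), of complex_of_real]
    by (simp add: k_def weight_def a_def b_def c_def)
  text \<open>Cramer's rule for the first two equations, divided by the factor \<open>c\<close>, which may vanish.\<close>
  define x y z where "x = cnj \<gamma> * k + \<alpha> * \<beta> * b" and "y = \<beta> * k + cnj \<alpha> * cnj \<gamma> * a"
    and "z = a + b"
  have 1: "\<alpha> * (b * y) + cnj \<gamma> * (c * z) = k * x"
    and 2: "cnj \<alpha> * (a * x) + \<beta> * (c * z) = k * y"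
    and 3: "\<gamma> * (a * x) + cnj \<beta> * (b * y) = k * z"
  proof -
    have "\<alpha> * (b * y) + cnj \<gamma> * (c * z) =
        \<alpha> * \<beta> * b * k + (\<alpha> * cnj \<alpha>) * cnj \<gamma> * a * b + cnj \<gamma> * c * (a + b)"
      unfolding y_def z_def by (simp add: algebra_simps)
    also have "\<dots> = cnj \<gamma> * (a * b + b * c + a * c) + \<alpha> * \<beta> * b * k"
      unfolding unit by (simp add: algebra_simps)
    finally show "\<alpha> * (b * y) + cnj \<gamma> * (c * z) = k * x"
      unfolding k2[symmetric] x_def by (simp add: algebra_simps power2_eq_square)
    have "cnj \<alpha> * (a * x) + \<beta> * (c * z) =
        cnj \<alpha> * cnj \<gamma> * a * k + (\<alpha> * cnj \<alpha>) * \<beta> * a * b + \<beta> * c * (a + b)"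
      unfolding x_def z_def by (simp add: algebra_simps)
    also have "\<dots> = \<beta> * (a * b + b * c + a * c) + cnj \<alpha> * cnj \<gamma> * a * k"
      unfolding unit by (simp add: algebra_simps)
    finally show "cnj \<alpha> * (a * x) + \<beta> * (c * z) = k * y"
      unfolding k2[symmetric] y_def by (simp add: algebra_simps power2_eq_square)
    have "\<gamma> * (a * x) + cnj \<beta> * (b * y) =
        (\<gamma> * cnj \<gamma>) * a * k + (\<alpha> * \<beta> * \<gamma> + cnj \<alpha> * cnj \<beta> * cnj \<gamma>) * a * b + (\<beta> * cnj \<beta>) * b * k"
      unfolding x_def y_def by (simp add: algebra_simps)
    then show "\<gamma> * (a * x) + cnj \<beta> * (b * y) = k * z"
      unfolding unit imag z_def by (simp add: algebra_simps)
  qed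
  define f where "f = (\<lambda>u. if u \<in> A then x else if u \<in> B then y else if u \<in> C then z else 0)"
  have "sum f A = (\<Sum>u\<in>A. x)" "sum f B = (\<Sum>u\<in>B. y)" "sum f C = (\<Sum>u\<in>C. z)"
    unfolding f_def by (rule sum.cong; auto dest: notin)+
  then have "(\<Sum>v\<in>verts D. herm_adj D u v * f v) = k * f u" for u
    using 1 2 3 by (simp add: row_sum f_def a_def b_def c_def)
  \<comment> \<open>The value \<open>z\<close> is visibly nonzero but belongs to \<open>C\<close>,
    which may be empty, so the nonzero entry is sought on \<open>A\<close>. If \<open>x\<close> were
    zero, \<open>k\<close> would be \<open>- (\<alpha> * \<beta> * \<gamma> * b)\<close>, an
    imaginary number, although it is a positive real.\<close>
  moreover have "x \<noteq> 0"
  proof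
    assume x0: "x = 0"
    have "\<gamma> * x = (\<gamma> * cnj \<gamma>) * k + (\<alpha> * \<beta> * \<gamma>) * b"
      unfolding x_def by (simp add: algebra_simps)
    then have "k + (\<alpha> * \<beta> * \<gamma>) * b = 0"
      unfolding unit x0 by simp
    then have "k = - (\<alpha> * \<beta> * \<gamma> * b)"
      by (rule eq_neg_iff_add_eq_0[THEN iffD2])
    moreover have "Re (\<alpha> * \<beta> * \<gamma>) = 0"
      using arg_cong[OF imag, of Re] by (simp add: algebra_simps)
    ultimately have "Re k = 0"
      by (simp add: b_def)
    with assms(1) show False by (simp add: k_def)
  qed
  ultimately show ?thesis
    unfolding H_eigenvalue_def using ne sub
    by (intro exI[of _ f]) (auto simp: f_def k_def)
qed

lemma positive_eigenvalue: "is_the_positive_H_eigenvalue D (sqrt weight)"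
proof -
  have "0 < weight"
    using ne fin by (simp add: weight_def card_gt_0_iff)
  then have pos: "0 < sqrt weight"
    by simp
  have "\<mu> = sqrt weight" if "0 < \<mu>" "H_eigenvalue D (complex_of_real \<mu>)" for \<mu>
  proof -
    have "complex_of_real (\<mu>\<^sup>2) = complex_of_real (of_nat weight)"
      using eigenvalue_weight[OF that(2)] that(1) by simp
    then have "\<mu>\<^sup>2 = weight"
      using of_real_eq_iff by blast
    with that(1) show ?thesis
      by (simp add: real_sqrt_unique)
  qed
  with pos show ?thesis
    by (simp add: is_the_positive_H_eigenvalue_def weight_eigenvalue)
qed

end

subsection \<open>Switching\<close>

lemma unit_cases: "s \<in> {1, - 1, \<i>, - \<i>} \<Longrightarrow> inverse s = cnj s \<and> s * cnj s = 1"
  by auto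

lemma four_way_switching_sym:
  assumes "four_way_switching D D'"
  shows "four_way_switching D' D"
proof -
  obtain s where s: "\<And>v. v \<in> verts D \<Longrightarrow> s v \<in> {1, - 1, \<i>, - \<i>}"
    and H: "\<And>u v. u \<in> verts D \<Longrightarrow> v \<in> verts D \<Longrightarrow>
      herm_adj D' u v = inverse (s u) * herm_adj D u v * s v"
    and V: "verts D' = verts D"
    using assms unfolding four_way_switching_def by blast
  have "inverse (s v) \<in> {1, - 1, \<i>, - \<i>}" if "v \<in> verts D" for v
    using s[OF that] by auto
  moreover have "s v \<noteq> 0" if "v \<in> verts D" for v
    using s[OF that] by auto
  ultimately show ?thesis
    unfolding four_way_switching_def using V H
    by (intro conjI exI[of _ "\<lambda>v. inverse (s v)"]) auto
qed

lemma herm_adj_converse: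
  assumes "mixed_graph D"
  shows "herm_adj (converse_mgraph D) u v = herm_adj D v u"
  using assms by (auto simp: herm_adj_def converse_mgraph_def mixed_graph_def insert_commute)

lemma mixed_graph_converse:
  assumes "mixed_graph D"
  shows "mixed_graph (converse_mgraph D)"
proof -
  have "\<forall>u v. (v, u) \<in> arcs D \<longrightarrow> (u, v) \<notin> arcs D \<and> {u, v} \<notin> edges D"
    using assms unfolding mixed_graph_def by (metis insert_commute)
  with assms show ?thesis
    by (auto simp: converse_mgraph_def mixed_graph_def)
qed

lemma converse_converse_mgraph: "converse_mgraph (converse_mgraph D) = D"
  by (simp add: converse_mgraph_def)

lemma verts_converse [simp]: "verts (converse_mgraph D) = verts D"
  by (simp add: converse_mgraph_def)

lemma switching_step_sym: "switching_step D D' \<Longrightarrow> switching_step D' D"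
  by (metis switching_step_def four_way_switching_sym converse_converse_mgraph)

text \<open>A switching rescales an eigenvector by the diagonal \<open>s\<close>. The converse has
  the conjugate matrix, so there the eigenvector is conjugated, and its eigenvalue survives because
  it is real.\<close>

lemma H_eigenvalue_switching_step:
  assumes "switching_step D D'" "H_eigenvalue D' (complex_of_real k)"
  shows "H_eigenvalue D (complex_of_real k)"
proof -
  obtain x :: "'a \<Rightarrow> complex" where nz: "\<exists>v\<in>verts D'. x v \<noteq> 0"
    and ev: "\<And>u. u \<in> verts D' \<Longrightarrow> (\<Sum>v\<in>verts D'. herm_adj D' u v * x v) = k * x u"
    using assms(2) unfolding H_eigenvalue_def by blast
  have D: "mixed_graph D"
    using assms(1) by (simp add: switching_step_def)
  consider "four_way_switching D D'" | "D' = converse_mgraph D"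
    using assms(1) by (auto simp: switching_step_def)
  then show ?thesis
  proof cases
    case 1
    then obtain s where V: "verts D' = verts D"
      and s: "\<And>v. v \<in> verts D \<Longrightarrow> s v \<in> {1, - 1, \<i>, - \<i>}"
      and H: "\<And>u v. u \<in> verts D \<Longrightarrow> v \<in> verts D \<Longrightarrow>
        herm_adj D' u v = inverse (s u) * herm_adj D u v * s v"
      unfolding four_way_switching_def by blast
    have s0: "s v \<noteq> 0" if "v \<in> verts D" for v
      using s[OF that] by auto
    have "(\<Sum>v\<in>verts D. herm_adj D u v * (s v * x v)) = k * (s u * x u)" if u: "u \<in> verts D" for u
    proof -
      have "(\<Sum>v\<in>verts D. herm_adj D u v * (s v * x v)) =
          s u * (\<Sum>v\<in>verts D. herm_adj D' u v * x v)"
        unfolding sum_distrib_left using u s0 by (intro sum.cong) (auto simp: H)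
      then show ?thesis
        using ev[of u] u V by simp
    qed
    moreover have "\<exists>v\<in>verts D. s v * x v \<noteq> 0"
      using nz s0 V by auto
    ultimately show ?thesis
      unfolding H_eigenvalue_def by (intro exI[of _ "\<lambda>v. s v * x v"]) simp
  next
    case 2
    have "(\<Sum>v\<in>verts D. herm_adj D u v * cnj (x v)) = k * cnj (x u)" if u: "u \<in> verts D" for u
    proof -
      have "(\<Sum>v\<in>verts D. herm_adj D u v * cnj (x v)) =
          cnj (\<Sum>v\<in>verts D. herm_adj D' u v * x v)"
        using D 2 by (simp add: herm_adj_converse herm_adj_cnj[of D u] cnj_sum)
      also have "\<dots> = cnj (k * x u)"
        using ev[of u] u 2 by simp
      finally show ?thesis
        by simp
    qed
    moreover have "\<exists>v\<in>verts D. cnj (x v) \<noteq> 0"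
      using nz 2 by auto
    ultimately show ?thesis
      unfolding H_eigenvalue_def by (intro exI[of _ "\<lambda>v. cnj (x v)"]) simp
  qed
qed

text \<open>The invariant that tells the two families apart. It looks only at which entries vanish,
  since switching changes the others by units. In a mixed graph the zero diagonal makes the three
  vertices distinct.\<close>

definition has_triangle :: "'a mgraph \<Rightarrow> bool" where
  "has_triangle D \<longleftrightarrow> (\<exists>u\<in>verts D. \<exists>v\<in>verts D. \<exists>w\<in>verts D.
     herm_adj D u v \<noteq> 0 \<and> herm_adj D v w \<noteq> 0 \<and> herm_adj D w u \<noteq> 0)"

lemma switching_step_invariants:
  assumes "switching_step D D'"
  shows "verts D' = verts D" "herm_adj D' u v = 0 \<longleftrightarrow> herm_adj D u v = 0"
proof -
  have D: "mixed_graph D" "mixed_graph D'"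
    using assms by (auto simp: switching_step_def)
  show V: "verts D' = verts D"
    using assms by (auto simp: switching_step_def four_way_switching_def)
  show "herm_adj D' u v = 0 \<longleftrightarrow> herm_adj D u v = 0"
  proof (cases "u \<in> verts D \<and> v \<in> verts D")
    case True
    have "herm_adj D v u = 0 \<longleftrightarrow> herm_adj D u v = 0"
      using herm_adj_cnj[OF D(1), of u v] by simp
    consider "four_way_switching D D'" | "D' = converse_mgraph D"
      using assms by (auto simp: switching_step_def)
    then show ?thesis
    proof cases
      case 1
      then obtain s where "\<forall>v\<in>verts D. s v \<in> {1, - 1, \<i>, - \<i>}"
        "herm_adj D' u v = inverse (s u) * herm_adj D u v * s v"
        using True unfolding four_way_switching_def by blast
      with True show ?thesis
        by force
    next
      case 2
      with \<open>herm_adj D v u = 0 \<longleftrightarrow> herm_adj D u v = 0\<close> D show ?thesis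
        by (simp add: herm_adj_converse)
    qed
  next
    case False
    then show ?thesis
      using V D by (auto simp: herm_adj_outside)
  qed
qed

lemma switching_equivalent_invariants:
  assumes "switching_equivalent D D'"
  shows "order D = order D' \<and>
    (\<forall>k::real. H_eigenvalue D k \<longleftrightarrow> H_eigenvalue D' k) \<and> (has_triangle D \<longleftrightarrow> has_triangle D')"
  using assms unfolding switching_equivalent_def
proof (induction rule: rtranclp_induct)
  case (step E E')
  have "H_eigenvalue E (complex_of_real k) \<longleftrightarrow> H_eigenvalue E' (complex_of_real k)" for k
    using step.hyps(2) switching_step_sym H_eigenvalue_switching_step by blast
  moreover have "order E = order E'" "has_triangle E \<longleftrightarrow> has_triangle E'"
    using switching_step_invariants[OF step.hyps(2)] by (simp_all add: order_def has_triangle_def)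
  ultimately show ?case
    using step.IH by simp
qed simp

subsection \<open>Isomorphism\<close>

lemma mgraph_iso_sym:
  assumes "mgraph_iso D E"
  shows "mgraph_iso E D"
proof -
  obtain f where f: "bij_betw f (verts D) (verts E)"
    and e: "\<And>u v. u \<in> verts D \<Longrightarrow> v \<in> verts D \<Longrightarrow>
      ({u, v} \<in> edges D \<longleftrightarrow> {f u, f v} \<in> edges E) \<and> ((u, v) \<in> arcs D \<longleftrightarrow> (f u, f v) \<in> arcs E)"
    using assms by (auto simp: mgraph_iso_def)
  let ?g = "inv_into (verts D) f"
  have g: "?g u \<in> verts D" "f (?g u) = u" if "u \<in> verts E" for u
    using f that by (auto simp: bij_betw_def inv_into_into f_inv_into_f)
  show ?thesis
    unfolding mgraph_iso_def
    using bij_betw_inv_into[OF f] e[OF g(1) g(1)] g(2)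
    by (intro exI[of _ ?g]) simp
qed

lemma mgraph_iso_herm_adj:
  assumes "mgraph_iso D E"
  obtains f where "bij_betw f (verts D) (verts E)"
    "\<And>u v. u \<in> verts D \<Longrightarrow> v \<in> verts D \<Longrightarrow> herm_adj E (f u) (f v) = herm_adj D u v"
proof -
  obtain f where f: "bij_betw f (verts D) (verts E)"
    "\<And>u v. u \<in> verts D \<Longrightarrow> v \<in> verts D \<Longrightarrow>
      ({u, v} \<in> edges D \<longleftrightarrow> {f u, f v} \<in> edges E) \<and> ((u, v) \<in> arcs D \<longleftrightarrow> (f u, f v) \<in> arcs E)"
    using assms by (auto simp: mgraph_iso_def)
  then show thesis
    by (intro that[of f]) (simp_all add: herm_adj_def)
qed

lemma H_eigenvalue_mgraph_iso:
  assumes "mgraph_iso D E" "H_eigenvalue E k"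
  shows "H_eigenvalue D k"
proof -
  obtain f where f: "bij_betw f (verts D) (verts E)"
    and H: "\<And>u v. u \<in> verts D \<Longrightarrow> v \<in> verts D \<Longrightarrow> herm_adj E (f u) (f v) = herm_adj D u v"
    using mgraph_iso_herm_adj[OF assms(1)] by blast
  obtain x where nz: "\<exists>v\<in>verts E. x v \<noteq> 0"
    and ev: "\<And>u. u \<in> verts E \<Longrightarrow> (\<Sum>v\<in>verts E. herm_adj E u v * x v) = k * x u"
    using assms(2) unfolding H_eigenvalue_def by blast
  have fV: "f ` verts D = verts E"
    using f by (simp add: bij_betw_def)
  have "(\<Sum>v\<in>verts D. herm_adj D u v * x (f v)) = k * x (f u)" if "u \<in> verts D" for u
  proof -
    have "(\<Sum>v\<in>verts D. herm_adj D u v * x (f v)) = (\<Sum>v\<in>verts D. herm_adj E (f u) (f v) * x (f v))"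
      using that by (simp add: H)
    also have "\<dots> = (\<Sum>v\<in>verts E. herm_adj E (f u) v * x v)"
      by (rule sum.reindex_bij_betw[OF f])
    finally show ?thesis
      using ev that fV by auto
  qed
  moreover have "\<exists>v\<in>verts D. x (f v) \<noteq> 0"
    using nz unfolding fV[symmetric] by auto
  ultimately show ?thesis
    unfolding H_eigenvalue_def by (intro exI[of _ "\<lambda>v. x (f v)"]) simp
qed

lemma has_triangle_mgraph_iso:
  assumes "mgraph_iso D E" "has_triangle D"
  shows "has_triangle E"
proof -
  obtain f where f: "bij_betw f (verts D) (verts E)"
    and H: "\<And>u v. u \<in> verts D \<Longrightarrow> v \<in> verts D \<Longrightarrow> herm_adj E (f u) (f v) = herm_adj D u v"
    using mgraph_iso_herm_adj[OF assms(1)] by blast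
  then have "f u \<in> verts E" if "u \<in> verts D" for u
    using that by (auto simp: bij_betw_def)
  with assms(2) H show ?thesis
    unfolding has_triangle_def by metis
qed

text \<open>Everything that the theorem asserts about \<open>D\<close> is read off from a model
  through these three facts.\<close>

lemma switching_equivalent_to_copy_invariants:
  assumes "switching_equivalent_to_copy D X"
  shows "order D = order X"
    and "H_eigenvalue D (complex_of_real k) \<longleftrightarrow> H_eigenvalue X (complex_of_real k)"
    and "has_triangle D \<longleftrightarrow> has_triangle X"
proof -
  obtain D' where eq: "switching_equivalent D D'" and iso: "mgraph_iso D' X"
    using assms by (auto simp: switching_equivalent_to_copy_def)
  have "order D' = order X"
    using iso bij_betw_same_card by (auto simp: mgraph_iso_def order_def)
  moreover have "H_eigenvalue D' k \<longleftrightarrow> H_eigenvalue X k" for k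
    using H_eigenvalue_mgraph_iso[OF iso] H_eigenvalue_mgraph_iso[OF mgraph_iso_sym[OF iso]] by blast
  moreover have "has_triangle D' \<longleftrightarrow> has_triangle X"
    using has_triangle_mgraph_iso[OF iso] has_triangle_mgraph_iso[OF mgraph_iso_sym[OF iso]] by blast
  ultimately show "order D = order X"
    "H_eigenvalue D (complex_of_real k) \<longleftrightarrow> H_eigenvalue X (complex_of_real k)"
    "has_triangle D \<longleftrightarrow> has_triangle X"
    using switching_equivalent_invariants[OF eq] by auto
qed

text \<open>The entries depend only on the classes of the two vertices, so any bijection respecting
  the classes and the isolated rest is an isomorphism.\<close>

lemma (in tri_blowup) mgraph_iso:
  assumes E: "tri_blowup E A' B' C' \<alpha> \<beta> \<gamma>"
    and card: "card A = card A'" "card B = card B'" "card C = card C'" "card (verts D) = card (verts E)"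
  shows "mgraph_iso D E"
proof -
  interpret E: tri_blowup E A' B' C' \<alpha> \<beta> \<gamma> by (rule E)
  let ?T = "verts D - (A \<union> B \<union> C)" and ?T' = "verts E - (A' \<union> B' \<union> C')"
  have "card (A \<union> B \<union> C) = card A + card B + card C"
    "card (A' \<union> B' \<union> C') = card A' + card B' + card C'"
    using fin disj E.fin E.disj by (simp_all add: card_Un_disjoint Int_Un_distrib2)
  then have "card ?T = card ?T'"
    using card sub fin E.sub E.fin by (simp add: card_Diff_subset)
  then obtain f1 f2 f3 f4 where f: "bij_betw f1 A A'" "bij_betw f2 B B'" "bij_betw f3 C C'"
    "bij_betw f4 ?T ?T'"
    using card fin E.fin finite_same_card_bij by (metis finite_Diff)
  define f where "f u = (if u \<in> A then f1 u else if u \<in> B then f2 u else if u \<in> C then f3 u else f4 u)" for u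
  have fA: "bij_betw f A A'"
    using f(1) by (subst bij_betw_cong[of _ f f1]) (auto simp: f_def)
  have fB: "bij_betw f B B'"
    using f(2) disj by (subst bij_betw_cong[of _ f f2]) (auto simp: f_def)
  have fC: "bij_betw f C C'"
    using f(3) disj by (subst bij_betw_cong[of _ f f3]) (auto simp: f_def)
  have fT: "bij_betw f ?T ?T'"
    using f(4) by (subst bij_betw_cong[of _ f f4]) (auto simp: f_def)
  have "bij_betw f (A \<union> B \<union> C \<union> ?T) (A' \<union> B' \<union> C' \<union> ?T')"
    using fA fB fC fT E.disj by (intro bij_betw_combine) auto
  moreover have "A \<union> B \<union> C \<union> ?T = verts D" "A' \<union> B' \<union> C' \<union> ?T' = verts E"
    using sub E.sub by auto
  ultimately have bij: "bij_betw f (verts D) (verts E)" by simp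
  have "(f u \<in> A' \<longleftrightarrow> u \<in> A) \<and> (f u \<in> B' \<longleftrightarrow> u \<in> B) \<and> (f u \<in> C' \<longleftrightarrow> u \<in> C)" if u: "u \<in> verts D" for u
  proof -
    consider "u \<in> A" | "u \<in> B" | "u \<in> C" | "u \<in> ?T"
      using u by blast
    then show ?thesis
    proof cases
      case 1
      then show ?thesis
        using bij_betwE[OF fA] notin(1) E.notin(1) by blast
    next
      case 2
      then show ?thesis
        using bij_betwE[OF fB] notin(2) E.notin(2) by blast
    next
      case 3
      then show ?thesis
        using bij_betwE[OF fC] notin(3) E.notin(3) by blast
    next
      case 4
      then show ?thesis
        using bij_betwE[OF fT] by blast
    qed
  qed
  then have "herm_adj E (f u) (f v) = herm_adj D u v" if "u \<in> verts D" "v \<in> verts D" for u v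
    using that unfolding herm E.herm tri_mat_def by simp
  with bij show ?thesis
    unfolding mgraph_iso_def edges_iff_herm_adj arcs_iff_herm_adj[OF mixed] arcs_iff_herm_adj[OF E.mixed]
    by auto
qed

lemma (in tri_blowup) has_triangle_iff: "has_triangle D \<longleftrightarrow> C \<noteq> {}"
proof
  assume "has_triangle D"
  \<comment> \<open>With \<open>C\<close> empty every edge changes sides, which a closed walk of
    length 3 cannot do.\<close>
  moreover have "u \<in> A \<longleftrightarrow> v \<notin> A" if "herm_adj D u v \<noteq> 0" "C = {}" for u v
    using that disj(1) by (auto simp: herm tri_mat_def split: if_splits)
  ultimately show "C \<noteq> {}"
    unfolding has_triangle_def by metis
next
  assume "C \<noteq> {}"
  then obtain p q r where "p \<in> A" "q \<in> B" "r \<in> C"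
    using ne by blast
  then have "herm_adj D p q = \<alpha>" "herm_adj D q r = \<beta>" "herm_adj D r p = \<gamma>"
    by (auto simp: herm tri_mat_def dest: notin)
  moreover have "\<alpha> \<noteq> 0" "\<beta> \<noteq> 0" "\<gamma> \<noteq> 0" "p \<in> verts D" "q \<in> verts D" "r \<in> verts D"
    using unit sub \<open>p \<in> A\<close> \<open>q \<in> B\<close> \<open>r \<in> C\<close> by auto
  ultimately show "has_triangle D"
    unfolding has_triangle_def by blast
qed

subsection \<open>The two families\<close>

lemma Inl_pair_mem_image_iff: "{Inl u, Inl v} \<in> (\<lambda>e. Inl ` e) ` E \<longleftrightarrow> {u, v} \<in> E"
  using inj_image_mem_iff[OF inj_on_image[of Inl UNIV], of "{u, v}" E] by (simp add: Pow_UNIV)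

lemma herm_adj_add_isolated:
  "herm_adj (add_isolated X t) (Inl u) (Inl v) = herm_adj X u v"
  "herm_adj (add_isolated X t) (Inr i) w = 0"
  "herm_adj (add_isolated X t) w (Inr i) = 0"
proof -
  show "herm_adj (add_isolated X t) (Inl u) (Inl v) = herm_adj X u v"
    by (auto simp: herm_adj_def add_isolated_def Inl_pair_mem_image_iff)
qed (auto simp: herm_adj_def add_isolated_def)

lemma mixed_graph_add_isolated:
  assumes "mixed_graph X"
  shows "mixed_graph (add_isolated X t)"
proof -
  have "Inl ` e \<in> {{u, v} | u v. u \<in> verts (add_isolated X t) \<and> v \<in> verts (add_isolated X t) \<and> u \<noteq> v}"
    if "e \<in> edges X" for e
  proof -
    have "e \<in> {{u, v} | u v. u \<in> verts X \<and> v \<in> verts X \<and> u \<noteq> v}"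
      using assms that unfolding mixed_graph_def by blast
    then obtain u v where "e = {u, v}" "u \<in> verts X" "v \<in> verts X" "u \<noteq> v"
      by blast
    then show ?thesis
      by (intro CollectI exI[of _ "Inl u"] exI[of _ "Inl v"]) (simp add: add_isolated_def)
  qed
  moreover have "(Inl u, Inl v) \<in> arcs (add_isolated X t) \<Longrightarrow> {Inl u, Inl v} \<notin> edges (add_isolated X t)" for u v
  proof -
    assume "(Inl u, Inl v) \<in> arcs (add_isolated X t)"
    then have "{u, v} \<notin> edges X"
      using assms by (auto simp: mixed_graph_def add_isolated_def)
    then show ?thesis
      by (simp add: add_isolated_def Inl_pair_mem_image_iff)
  qed
  ultimately show ?thesis
    using assms by (auto simp: mixed_graph_def add_isolated_def)
qed

lemma order_add_isolated:
  assumes "finite (verts X)"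
  shows "order (add_isolated X t) = card (verts X) + t"
proof -
  have "card (Inl ` verts X \<union> Inr ` {..<t}) = card (Inl ` verts X :: ('a + nat) set) + card (Inr ` {..<t} :: ('a + nat) set)"
    using assms by (intro card_Un_disjoint) auto
  then show ?thesis
    by (simp add: order_def add_isolated_def card_image)
qed

lemma tri_blowup_add_isolated:
  assumes "tri_blowup X A B C \<alpha> \<beta> \<gamma>"
  shows "tri_blowup (add_isolated X t) (Inl ` A) (Inl ` B) (Inl ` C) \<alpha> \<beta> \<gamma>"
proof -
  interpret X: tri_blowup X A B C \<alpha> \<beta> \<gamma> by (rule assms)
  have "herm_adj (add_isolated X t) u v = tri_mat \<alpha> \<beta> \<gamma> (Inl ` A) (Inl ` B) (Inl ` C) u v" for u v
    by (cases u; cases v) (auto simp: herm_adj_add_isolated X.herm tri_mat_def)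
  then have h: "herm_adj (add_isolated X t) = tri_mat \<alpha> \<beta> \<gamma> (Inl ` A) (Inl ` B) (Inl ` C)"
    by (intro ext)
  show ?thesis
    by (rule tri_blowup.intro[OF mixed_graph_add_isolated[OF X.mixed] _ _ _ _ _ _ _ _ h X.unit X.imag])
      (use X.sub X.disj X.ne in \<open>auto simp: add_isolated_def\<close>)
qed

text \<open>The edges fix \<alpha> as 1. The other two weights are chosen as units making the
  product \<open>\<i>\<close>, hence imaginary.\<close>

lemma tri_blowup_complete_bipartite:
  assumes "1 \<le> a" "1 \<le> b"
  shows "tri_blowup (complete_bipartite a b) {..<a} {a..<a + b} {} 1 1 \<i>"
proof -
  have "herm_adj (complete_bipartite a b) u v = tri_mat 1 1 \<i> {..<a} {a..<a + b} {} u v" for u v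
    by (auto simp: herm_adj_def complete_bipartite_def tri_mat_def doubleton_eq_iff)
  then have h: "herm_adj (complete_bipartite a b) = tri_mat 1 1 \<i> {..<a} {a..<a + b} {}"
    by (intro ext)
  have m: "mixed_graph (complete_bipartite a b)"
    unfolding mixed_graph_def complete_bipartite_def by fastforce
  show ?thesis
    by (rule tri_blowup.intro[OF m _ _ _ _ _ _ _ _ h]) (use assms in \<open>auto simp: lessThan_empty_iff complete_bipartite_def\<close>)
qed

lemma tri_blowup_C3:
  assumes "1 \<le> a" "1 \<le> b"
  shows "tri_blowup (C3 a b c) {..<a} {a..<a + b} {a + b..<a + b + c} \<i> \<i> \<i>"
proof -
  have "herm_adj (C3 a b c) u v = tri_mat \<i> \<i> \<i> {..<a} {a..<a + b} {a + b..<a + b + c} u v" for u v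
    by (auto simp: herm_adj_def C3_def Let_def tri_mat_def)
  then have h: "herm_adj (C3 a b c) = tri_mat \<i> \<i> \<i> {..<a} {a..<a + b} {a + b..<a + b + c}"
    by (intro ext)
  have m: "mixed_graph (C3 a b c)"
    by (auto simp: mixed_graph_def C3_def Let_def)
  show ?thesis
    by (rule tri_blowup.intro[OF m _ _ _ _ _ _ _ _ h]) (use assms in \<open>auto simp: lessThan_empty_iff C3_def Let_def\<close>)
qed

subsection \<open>Mixed graphs of rank 2\<close>

text \<open>Reads a mixed graph back from its matrix. A switching is specified by a matrix identity,
  but a step of the equivalence needs an actual graph as its target.\<close>

definition herm_graph :: "'a set \<Rightarrow> ('a \<Rightarrow> 'a \<Rightarrow> complex) \<Rightarrow> 'a mgraph" where
  "herm_graph V M =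
     \<lparr>verts = V, edges = {{u, v} | u v. M u v = 1}, arcs = {(u, v). M u v = \<i>}\<rparr>"

lemma herm_graph:
  assumes "finite V" and val: "\<And>u v. M u v \<in> {0, 1, \<i>, - \<i>}"
    and cnj: "\<And>u v. M v u = cnj (M u v)" and diag: "\<And>u. M u u = 0"
    and out: "\<And>u v. M u v \<noteq> 0 \<Longrightarrow> u \<in> V"
  shows "mixed_graph (herm_graph V M)" "herm_adj (herm_graph V M) = M"
proof -
  have V: "u \<in> V \<and> v \<in> V \<and> u \<noteq> v" if "M u v \<noteq> 0" for u v
    using out[of u v] out[of v u] that cnj[of v u] diag by auto
  have e: "{u, v} \<in> edges (herm_graph V M) \<longleftrightarrow> M u v = 1" for u v
    using cnj[of u v] by (auto simp: herm_graph_def doubleton_eq_iff)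
  have a: "(u, v) \<in> arcs (herm_graph V M) \<longleftrightarrow> M u v = \<i>" for u v
    by (simp add: herm_graph_def)
  have "edges (herm_graph V M) \<subseteq> {{u, v} | u v. u \<in> V \<and> v \<in> V \<and> u \<noteq> v}"
  proof
    fix x assume "x \<in> edges (herm_graph V M)"
    then obtain u v where "x = {u, v}" "M u v = 1"
      by (auto simp: herm_graph_def)
    with V[of u v] show "x \<in> {{u, v} | u v. u \<in> V \<and> v \<in> V \<and> u \<noteq> v}"
      by auto
  qed
  moreover have "arcs (herm_graph V M) \<subseteq> {(u, v). u \<in> V \<and> v \<in> V \<and> u \<noteq> v}"
  proof clarify
    fix u v assume "(u, v) \<in> arcs (herm_graph V M)"
    with V[of u v] show "u \<in> V \<and> v \<in> V \<and> u \<noteq> v"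
      by (simp add: a)
  qed
  moreover have "M v u \<noteq> \<i> \<and> M u v \<noteq> 1" if "M u v = \<i>" for u v
    using that cnj[of u v] by (simp add: complex_eq_iff)
  moreover have "verts (herm_graph V M) = V"
    by (simp add: herm_graph_def)
  ultimately show "mixed_graph (herm_graph V M)"
    using assms(1) by (simp add: mixed_graph_def e a)
  show "herm_adj (herm_graph V M) = M"
  proof (intro ext)
    fix u v
    have "M v u = \<i> \<longleftrightarrow> M u v = - \<i>"
      using cnj[of u v] by (auto simp: complex_eq_iff)
    then show "herm_adj (herm_graph V M) u v = M u v"
      using val[of u v] by (auto simp: herm_adj_def e a)
  qed
qed

text \<open>The Hermitian symmetry, the zero diagonal and the vanishing outside the vertex set are
  inherited from \<open>D\<close>. What a switching can destroy is the range of the entries, as it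
  may produce -1; hence the hypothesis \<open>val\<close>.\<close>

lemma switching_step_to_matrix:
  assumes D: "mixed_graph D" and s: "\<And>v. s v \<in> {1, - 1, \<i>, - \<i>}"
    and M: "\<And>u v. cnj (s u) * herm_adj D u v * s v = M u v"
    and val: "\<And>u v. M u v \<in> {0, 1, \<i>, - \<i>}"
  obtains D' where "mixed_graph D'" "verts D' = verts D" "herm_adj D' = M" "switching_step D D'"
proof -
  let ?D' = "herm_graph (verts D) M"
  have h1: "M v u = cnj (M u v)" for u v
    using herm_adj_cnj[OF D, of u v] by (simp add: M[symmetric])
  have h2: "M u u = 0" for u
    using D by (simp add: M[symmetric] herm_adj_diag)
  have h3: "u \<in> verts D" if "M u v \<noteq> 0" for u v
    using that herm_adj_outside[OF D, of u v] by (auto simp: M[symmetric])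
  have "finite (verts D)"
    using D by (simp add: mixed_graph_def)
  note D' = herm_graph[of "verts D" M, OF this val h1 h2 h3]
  have V: "verts ?D' = verts D"
    by (simp add: herm_graph_def)
  have "inverse (s u) = cnj (s u)" for u
    using unit_cases[OF s] by simp
  then have "four_way_switching D ?D'"
    unfolding four_way_switching_def using V s M D'(2) by (intro conjI exI[of _ s]) simp_all
  with D D' V show thesis
    by (intro that[of ?D']) (auto simp: switching_step_def)
qed

text \<open>Evaluating a linear dependency on the columns of an adjacent pair \<open>p, q\<close> in the rows \<open>p\<close> and
  \<open>q\<close> determines its coefficients.\<close>

lemma rank_2_factorization:
  assumes D: "mixed_graph D" and rank: "H_rank D = 2"
  obtains a b :: "'a \<Rightarrow> complex" and p q where
    "\<And>u v. herm_adj (D :: 'a mgraph) u v = a u * cnj (b v) + b u * cnj (a v)"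
    "\<And>u. a u \<in> {0, 1, - 1, \<i>, - \<i>}" "\<And>u. b u \<in> {0, 1, - 1, \<i>, - \<i>}"
    "a p = 0" "b p \<noteq> 0" "a q \<noteq> 0" "b q = 0"
proof -
  obtain p q where pq: "herm_adj D p q \<noteq> 0"
    using H_rank_edgeless[of D] rank by fastforce
  then have V: "p \<in> verts D" "q \<in> verts D"
    using D herm_adj_outside by metis+
  define h where "h = herm_adj D p q"
  have h: "h \<in> {1, - 1, \<i>, - \<i>}"
    using pq herm_adj_values[of D p q] by (auto simp: h_def)
  then have hh: "h * cnj h = 1" and h0: "h \<noteq> 0"
    by auto
  \<comment> \<open>Solving for the coefficients brings in the pivot \<open>h\<close> and its
    conjugate. The factor \<open>cnj h\<close> absorbs both, so that the two summands of the
    factorization mirror each other.\<close>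
  define a b where "a u = herm_adj D u p" and "b u = cnj h * herm_adj D u q" for u
  have fact: "herm_adj D u v = a u * cnj (b v) + b u * cnj (a v)" for u v
  proof (cases "v \<in> verts D")
    case True
    then obtain l m where lm: "\<And>y. herm_adj D y v = l * herm_adj D y p + m * herm_adj D y q"
      using H_rank_2_iff[OF D V pq] rank by blast
    have "herm_adj D p v = m * h"
      using lm[of p] D by (simp add: herm_adj_diag h_def)
    then have "m = cnj h * herm_adj D p v"
      using hh by (simp add: mult.left_commute mult.commute)
    moreover have "herm_adj D q v = l * cnj h"
      using lm[of q] D herm_adj_cnj[OF D, of p q] by (simp add: herm_adj_diag h_def)
    then have "l = h * herm_adj D q v"
      using hh by (simp add: mult.left_commute)
    ultimately show ?thesis
      using lm[of u] herm_adj_cnj[OF D, of v p] herm_adj_cnj[OF D, of v q]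
      by (simp add: a_def b_def)
  next
    case False
    then show ?thesis
      using D by (simp add: a_def b_def herm_adj_outside)
  qed
  have "a u \<in> {0, 1, - 1, \<i>, - \<i>}" "b u \<in> {0, 1, - 1, \<i>, - \<i>}" for u
    using herm_adj_values[of D u p] herm_adj_values[of D u q] h by (auto simp: a_def b_def)
  moreover have "a p = 0" "b p \<noteq> 0" "a q \<noteq> 0" "b q = 0"
    using D pq h0 herm_adj_cnj[OF D, of p q] by (simp_all add: a_def b_def herm_adj_diag)
  ultimately show thesis
    using that fact by blast
qed

text \<open>Take for \<open>s\<close> the first nonzero number of the pair. Once \<open>a\<close> is
  1, the hypothesis says that the real part of \<open>b\<close> is 0.\<close>

lemma unit_pair_normal_form:
  fixes a b :: complex
  assumes "a \<in> {0, 1, - 1, \<i>, - \<i>}" "b \<in> {0, 1, - 1, \<i>, - \<i>}" "a * cnj b + b * cnj a = 0"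
  shows "\<exists>s. s \<in> {1, - 1, \<i>, - \<i>} \<and>
    (cnj s * a, cnj s * b) \<in> {(0, 0), (1, 0), (0, 1), (1, \<i>), (1, - \<i>)}"
proof -
  consider "a = 0" "b = 0" | "a = 0" "b \<noteq> 0" | "a \<noteq> 0" by blast
  then show ?thesis
  proof cases
    case 1
    then show ?thesis by (intro exI[of _ 1]) simp
  next
    case 2
    with assms show ?thesis by (intro exI[of _ b]) auto
  next
    case 3
    with assms show ?thesis by (intro exI[of _ a]) auto
  qed
qed

text \<open>The result stays on the level of matrices, so that a further switching can be multiplied
  into \<open>s\<close> before a graph is formed.\<close>

lemma rank_2_switching_class:
  fixes D :: "'a mgraph"
  assumes D: "mixed_graph D" and rank: "H_rank D = 2"
  obtains A B C s \<gamma> where "A \<subseteq> verts D" "B \<subseteq> verts D" "C \<subseteq> verts D"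
    "A \<inter> B = {}" "B \<inter> C = {}" "A \<inter> C = {}" "A \<noteq> {}" "B \<noteq> {}"
    "\<gamma> \<in> {\<i>, - \<i>}" "\<And>v. s v \<in> {1, - 1, \<i>, - \<i>}"
    "\<And>u v. cnj (s u) * herm_adj D u v * s v = tri_mat 1 1 \<gamma> A B C u v"
proof -
  obtain a b p q where H: "\<And>u v. herm_adj D u v = a u * cnj (b v) + b u * cnj (a v)"
    and ab: "\<And>u. a u \<in> {0, 1, - 1, \<i>, - \<i>}" "\<And>u. b u \<in> {0, 1, - 1, \<i>, - \<i>}"
    and pq: "a p = 0" "b p \<noteq> 0" "a q \<noteq> 0" "b q = 0"
    using rank_2_factorization[OF assms] by metis
  have "\<forall>u. \<exists>s. s \<in> {1, - 1, \<i>, - \<i>} \<and>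
      (cnj s * a u, cnj s * b u) \<in> {(0, 0), (1, 0), (0, 1), (1, \<i>), (1, - \<i>)}"
    using unit_pair_normal_form[OF ab] H D by (metis herm_adj_diag)
  then obtain s where s: "\<And>u. s u \<in> {1, - 1, \<i>, - \<i>}"
    and nf: "\<And>u. (cnj (s u) * a u, cnj (s u) * b u) \<in> {(0, 0), (1, 0), (0, 1), (1, \<i>), (1, - \<i>)}"
    by metis
  define a' b' where "a' u = cnj (s u) * a u" and "b' u = cnj (s u) * b u" for u
  have nf': "a' u = 0 \<and> b' u \<in> {0, 1} \<or> a' u = 1 \<and> b' u \<in> {0, \<i>, - \<i>}" for u
    using nf[of u] by (auto simp: a'_def b'_def)
  have H': "cnj (s u) * herm_adj D u v * s v = a' u * cnj (b' v) + b' u * cnj (a' v)" for u v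
    unfolding H a'_def b'_def by (simp add: algebra_simps)
  have s0: "s u \<noteq> 0" for u
    using s[of u] by auto
  text \<open>Two vertices of types \<open>(1, \<i>)\<close> and \<open>(1, - \<i>)\<close> would give an entry of modulus 2.\<close>
  have no_mix: "b' v \<noteq> - \<i>" if "a' u = 1" "b' u = \<i>" "a' v = 1" for u v
  proof
    assume "b' v = - \<i>"
    with that have "cnj (s u) * herm_adj D u v * s v = 2 * \<i>"
      unfolding H' by simp
    then have "norm (cnj (s u) * herm_adj D u v * s v) = 2"
      by (simp add: norm_mult)
    moreover have "norm (s w) = 1" for w
      using s[of w] by auto
    moreover have "norm (herm_adj D u v) \<le> 1"
      using herm_adj_values[of D u v] by auto
    ultimately show False
      by (simp add: norm_mult)
  qed
  \<comment> \<open>If no pair is \<open>(1, \<i>)\<close>, the only possible third type is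
    \<open>(1, - \<i>)\<close>. It is then taken as the type of \<open>C\<close> even if
    \<open>C\<close> turns out to be empty.\<close>
  define \<gamma> where "\<gamma> = (if \<exists>u. a' u = 1 \<and> b' u = \<i> then \<i> else - \<i>)"
  define A B C where "A = {u. a' u = 1 \<and> b' u = 0}" and "B = {u. a' u = 0 \<and> b' u = 1}"
    and "C = {u. a' u = 1 \<and> b' u = \<gamma>}"
  have \<gamma>: "\<gamma> \<in> {\<i>, - \<i>}"
    by (simp add: \<gamma>_def)
  have nf'': "a' u = 0 \<and> b' u = 0 \<or> a' u = 0 \<and> b' u = 1 \<or> a' u = 1 \<and> b' u = 0 \<or>
      a' u = 1 \<and> b' u = \<gamma>" for u
    using nf'[of u] no_mix[of _ u] unfolding \<gamma>_def by auto
  have \<gamma>': "\<gamma> \<noteq> 0" "\<gamma> \<noteq> 1" "cnj \<gamma> = - \<gamma>"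
    using \<gamma> by (auto simp: complex_eq_iff)
  \<comment> \<open>Inside \<open>C\<close> the entry is \<gamma> plus its conjugate, which is 0.
    This is where an imaginary \<gamma> makes \<open>C\<close> an independent class.\<close>
  have eq: "cnj (s u) * herm_adj D u v * s v = tri_mat 1 1 \<gamma> A B C u v" for u v
    unfolding H' using nf''[of u] nf''[of v]
    by (elim disjE conjE) (simp_all add: A_def B_def C_def tri_mat_def \<gamma>' \<gamma>'(1,2)[symmetric])
  have "q \<in> A" "p \<in> B"
    using nf'[of p] nf'[of q] pq s0 by (auto simp: A_def B_def a'_def b'_def)
  \<comment> \<open>The switched entries of \<open>u\<close> against \<open>p\<close> and
    \<open>q\<close> are \<open>a' u\<close> and \<open>b' u\<close>, so a point outside the graph
    has the pair \<open>(0, 0)\<close> and lies in no class.\<close>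
  moreover have "u \<in> verts D" if "u \<in> A \<union> B \<union> C" for u
  proof (rule ccontr)
    assume "u \<notin> verts D"
    then have "a' u * cnj (b' v) + b' u * cnj (a' v) = 0" for v
      using H'[of u v] D by (simp add: herm_adj_outside)
    from this[of p] this[of q] have "a' u = 0" "b' u = 0"
      using \<open>q \<in> A\<close> \<open>p \<in> B\<close> by (auto simp: A_def B_def)
    with that show False
      by (auto simp: A_def B_def C_def)
  qed
  moreover have "A \<inter> B = {}" "B \<inter> C = {}" "A \<inter> C = {}"
    using \<gamma> by (auto simp: A_def B_def C_def)
  ultimately show thesis
    using that[of A B C \<gamma> s] \<gamma> s eq by blast
qed

section \<open>Rearranging the classes of a directed triangle\<close>

lemma tri_blowup_rotate:
  assumes "tri_blowup D A B C \<i> \<i> \<i>" "C \<noteq> {}"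
  shows "tri_blowup D B C A \<i> \<i> \<i>"
proof -
  interpret tri_blowup D A B C \<i> \<i> \<i> by (rule assms)
  have h: "herm_adj D = tri_mat \<i> \<i> \<i> B C A"
    unfolding herm by (intro ext) (auto simp: tri_mat_def dest: notin)
  show ?thesis
    by (rule tri_blowup.intro[OF mixed _ _ _ _ _ _ _ _ h]) (use assms(2) sub disj ne in auto)
qed

text \<open>Reversing the arcs along \<open>A\<close>, \<open>B\<close>, \<open>C\<close> gives the
  cycle \<open>A\<close>, \<open>C\<close>, \<open>B\<close> with the same weight.\<close>

lemma tri_blowup_converse:
  assumes "tri_blowup D A B C \<i> \<i> \<i>" "C \<noteq> {}"
  shows "tri_blowup (converse_mgraph D) A C B \<i> \<i> \<i>"
proof -
  interpret tri_blowup D A B C \<i> \<i> \<i> by (rule assms)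
  have h: "herm_adj (converse_mgraph D) = tri_mat \<i> \<i> \<i> A C B"
  proof (intro ext)
    fix u v
    have m: "\<not> (x \<in> A \<and> x \<in> B)" "\<not> (x \<in> B \<and> x \<in> C)" "\<not> (x \<in> A \<and> x \<in> C)" for x
      using disj by auto
    show "herm_adj (converse_mgraph D) u v = tri_mat \<i> \<i> \<i> A C B u v"
      unfolding herm_adj_converse[OF mixed] herm using m[of u] m[of v]
      by (cases "u \<in> A"; cases "u \<in> B"; cases "u \<in> C") (auto simp: tri_mat_def)
  qed
  show ?thesis
    by (rule tri_blowup.intro[OF mixed_graph_converse[OF mixed] _ _ _ _ _ _ _ _ h])
      (use assms(2) sub disj ne in auto)
qed

text \<open>Rotations of \<open>D\<close> reach three of the six orders of the classes, and
  rotations of the converse reach the other three.\<close>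

lemma tri_blowup_sort:
  assumes D: "tri_blowup D A B C \<i> \<i> \<i>" and C: "C \<noteq> {}"
  obtains D' A' B' C' where "switching_equivalent D D'" "verts D' = verts D"
    "tri_blowup D' A' B' C' \<i> \<i> \<i>" "C' \<noteq> {}" "card A' \<le> card B'" "card B' \<le> card C'"
proof -
  interpret tri_blowup D A B C \<i> \<i> \<i> by (rule D)
  let ?E = "converse_mgraph D"
  have refl: "switching_equivalent D D"
    by (simp add: switching_equivalent_def)
  have conv: "switching_equivalent D ?E"
    using mixed mixed_graph_converse[OF mixed]
    by (auto simp: switching_equivalent_def switching_step_def)
  note D1 = tri_blowup_rotate[OF D C]
  note D2 = tri_blowup_rotate[OF D1 ne(1)]
  note E = tri_blowup_converse[OF D C]
  note E1 = tri_blowup_rotate[OF E ne(2)]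
  note E2 = tri_blowup_rotate[OF E1 ne(1)]
  consider "card A \<le> card B" "card B \<le> card C" | "card B \<le> card C" "card C \<le> card A"
    | "card C \<le> card A" "card A \<le> card B" | "card A \<le> card C" "card C \<le> card B"
    | "card C \<le> card B" "card B \<le> card A" | "card B \<le> card A" "card A \<le> card C"
    by linarith
  then show thesis
  proof cases
    case 1
    then show thesis using that[OF refl _ D C] by simp
  next
    case 2
    then show thesis using that[OF refl _ D1 ne(1)] by simp
  next
    case 3
    then show thesis using that[OF refl _ D2 ne(2)] by simp
  next
    case 4
    then show thesis using that[OF conv _ E ne(2)] by simp
  next
    case 5
    then show thesis using that[OF conv _ E1 ne(1)] by simp
  next
    case 6
    then show thesis using that[OF conv _ E2 C] by simp
  qed
qed

lemma rank_2_classification: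
  fixes D :: "'a mgraph"
  assumes D: "mixed_graph D" and rank: "H_rank D = 2"
  obtains D' A B where "switching_equivalent D D'" "verts D' = verts D"
      "tri_blowup D' A B {} 1 1 \<i>" "card A \<le> card B"
    | D' A B C where "switching_equivalent D D'" "verts D' = verts D"
      "tri_blowup D' A B C \<i> \<i> \<i>" "C \<noteq> {}" "card A \<le> card B" "card B \<le> card C"
proof -
  obtain A B C s \<gamma> where sub: "A \<subseteq> verts D" "B \<subseteq> verts D" "C \<subseteq> verts D"
    and disj: "A \<inter> B = {}" "B \<inter> C = {}" "A \<inter> C = {}" and ne: "A \<noteq> {}" "B \<noteq> {}"
    and \<gamma>: "\<gamma> \<in> {\<i>, - \<i>}" and s: "\<And>v. s v \<in> {1, - 1, \<i>, - \<i>}"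
    and M: "\<And>u v. cnj (s u) * herm_adj D u v * s v = tri_mat 1 1 \<gamma> A B C u v"
    using rank_2_switching_class[OF assms] by metis
  show thesis
  proof (cases "C = {}")
    case True
    have "tri_mat 1 1 \<gamma> A B C u v \<in> {0, 1, \<i>, - \<i>}" for u v
      by (simp add: tri_mat_def True)
    from switching_step_to_matrix[OF D s M this] obtain D' where
      D': "mixed_graph D'" "verts D' = verts D" "herm_adj D' = tri_mat 1 1 \<gamma> A B C" "switching_step D D'"
      by metis
    have eq: "switching_equivalent D D'"
      using D'(4) by (simp add: switching_equivalent_def r_into_rtranclp)
    \<comment> \<open>The weight 1 is real, so the two classes may be exchanged without changing the
      graph; this is how the smaller one comes first.\<close>
    have h: "herm_adj D' = tri_mat 1 1 \<i> A B {}" "herm_adj D' = tri_mat 1 1 \<i> B A {}"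
      unfolding D'(3) by (auto simp: tri_mat_def True fun_eq_iff)
    have "tri_blowup D' A B {} 1 1 \<i>"
      by (rule tri_blowup.intro[OF D'(1) _ _ _ _ _ _ _ _ h(1)]) (use D'(2) sub disj ne in auto)
    moreover have "tri_blowup D' B A {} 1 1 \<i>"
      by (rule tri_blowup.intro[OF D'(1) _ _ _ _ _ _ _ _ h(2)]) (use D'(2) sub disj ne in auto)
    ultimately show thesis
      using that(1)[OF eq D'(2)] by (meson nat_le_linear)
  next
    case False
    \<comment> \<open>This spreads the weights 1, 1, \<gamma> evenly around the triangle. The common
      value must have cube \<gamma>, since switching keeps the product, and
      \<open>- \<gamma>\<close> does because \<gamma> squared is -1.\<close>
    define s' where "s' u = s u * (if u \<in> B then - \<gamma> else if u \<in> C then - 1 else 1)" for u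
    have s': "s' v \<in> {1, - 1, \<i>, - \<i>}" for v
      using s[of v] \<gamma> by (auto simp: s'_def)
    define M' where "M' = tri_mat (- \<gamma>) (- \<gamma>) (- \<gamma>) A B C"
    have eqM: "cnj (s' u) * herm_adj D u v * s' v = M' u v" for u v
    proof -
      define e where "e u = (if u \<in> B then - \<gamma> else if u \<in> C then - 1 else 1)" for u
      have "cnj (s' u) * herm_adj D u v * s' v = cnj (e u) * tri_mat 1 1 \<gamma> A B C u v * e v"
        unfolding M[symmetric] s'_def e_def[symmetric] by (simp add: algebra_simps)
      also have "\<dots> = M' u v"
        using \<gamma> disj unfolding M'_def tri_mat_def e_def by auto
      finally show ?thesis .
    qed
    have valM: "M' u v \<in> {0, 1, \<i>, - \<i>}" for u v
      using \<gamma> by (auto simp: M'_def tri_mat_def)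
    obtain D' where D': "mixed_graph D'" "verts D' = verts D" "herm_adj D' = M'"
      "switching_step D D'"
      using switching_step_to_matrix[OF D s' eqM valM] by metis
    have eq: "switching_equivalent D D'"
      using D'(4) by (simp add: switching_equivalent_def r_into_rtranclp)
    \<comment> \<open>For \<gamma> equal to \<open>\<i>\<close> the common weight is
      \<open>- \<i>\<close>, so the arcs run from \<open>A\<close> to \<open>C\<close> to
      \<open>B\<close>. Exchanging the names of \<open>B\<close> and \<open>C\<close> corrects the
      direction.\<close>
    obtain B' C' where B'C': "tri_blowup D' A B' C' \<i> \<i> \<i>" "C' \<noteq> {}"
    proof (cases "\<gamma> = \<i>")
      case True
      have h: "herm_adj D' = tri_mat \<i> \<i> \<i> A C B"
        unfolding D'(3) M'_def True using disj by (auto simp: tri_mat_def fun_eq_iff)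
      have "tri_blowup D' A C B \<i> \<i> \<i>"
        by (rule tri_blowup.intro[OF D'(1) _ _ _ _ _ _ _ _ h]) (use D'(2) sub disj ne False in auto)
      with ne show thesis
        using that by blast
    next
      case nt: False
      have h: "herm_adj D' = tri_mat \<i> \<i> \<i> A B C"
        unfolding D'(3) M'_def using nt \<gamma> by simp
      have "tri_blowup D' A B C \<i> \<i> \<i>"
        by (rule tri_blowup.intro[OF D'(1) _ _ _ _ _ _ _ _ h]) (use D'(2) sub disj ne in auto)
      with False show thesis
        using that by blast
    qed
    obtain D'' A'' B'' C'' where "switching_equivalent D' D''" "verts D'' = verts D'"
      "tri_blowup D'' A'' B'' C'' \<i> \<i> \<i>" "C'' \<noteq> {}" "card A'' \<le> card B''" "card B'' \<le> card C''"
      using tri_blowup_sort[OF B'C'] by metis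
    moreover have "switching_equivalent D D''"
      using eq calculation(1) by (simp add: switching_equivalent_def)
    ultimately show thesis
      using that(2) D'(2) by metis
  qed
qed

section \<open>The models with isolated vertices, and the assembly of the theorem\<close>

lemma complete_bipartite_isolated:
  fixes a b t :: nat
  assumes "1 \<le> a" "a \<le> b"
  defines "X \<equiv> add_isolated (complete_bipartite a b) t"
  shows "mixed_graph X" "H_rank X = 2" "order X = a + b + t"
    "is_the_positive_H_eigenvalue X (sqrt (a * b))" "\<not> has_triangle X"
    "tri_blowup X (Inl ` {..<a}) (Inl ` {a..<a + b}) {} 1 1 \<i>"
proof -
  have "tri_blowup (complete_bipartite a b) {..<a} {a..<a + b} {} 1 1 \<i>"
    using assms by (intro tri_blowup_complete_bipartite) auto
  from tri_blowup_add_isolated[OF this, of t]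
  show t: "tri_blowup X (Inl ` {..<a}) (Inl ` {a..<a + b}) {} 1 1 \<i>"
    by (simp add: X_def)
  interpret tri_blowup X "Inl ` {..<a}" "Inl ` {a..<a + b}" "{}" 1 1 \<i> by (rule t)
  show "mixed_graph X" "H_rank X = 2" "\<not> has_triangle X"
    using mixed rank has_triangle_iff by auto
  show "order X = a + b + t"
    unfolding X_def by (subst order_add_isolated) (auto simp: complete_bipartite_def)
  show "is_the_positive_H_eigenvalue X (sqrt (a * b))"
    using positive_eigenvalue by (simp add: weight_def card_image)
qed

lemma C3_isolated:
  fixes a b c t :: nat
  assumes "1 \<le> a" "a \<le> b" "b \<le> c"
  defines "X \<equiv> add_isolated (C3 a b c) t"
  shows "mixed_graph X" "H_rank X = 2" "order X = a + b + c + t"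
    "is_the_positive_H_eigenvalue X (sqrt (a * b + b * c + a * c))" "has_triangle X"
    "tri_blowup X (Inl ` {..<a}) (Inl ` {a..<a + b}) (Inl ` {a + b..<a + b + c}) \<i> \<i> \<i>"
proof -
  have "tri_blowup (C3 a b c) {..<a} {a..<a + b} {a + b..<a + b + c} \<i> \<i> \<i>"
    using assms by (intro tri_blowup_C3) auto
  from tri_blowup_add_isolated[OF this, of t]
  show t: "tri_blowup X (Inl ` {..<a}) (Inl ` {a..<a + b}) (Inl ` {a + b..<a + b + c}) \<i> \<i> \<i>"
    by (simp add: X_def)
  interpret tri_blowup X "Inl ` {..<a}" "Inl ` {a..<a + b}" "Inl ` {a + b..<a + b + c}" \<i> \<i> \<i>
    by (rule t)
  show "mixed_graph X" "H_rank X = 2" "has_triangle X"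
    using mixed rank has_triangle_iff assms by auto
  have "verts (C3 a b c) = {..<a + b + c}"
    by (auto simp: C3_def Let_def)
  then show "order X = a + b + c + t"
    unfolding X_def by (subst order_add_isolated) auto
  show "is_the_positive_H_eigenvalue X (sqrt (a * b + b * c + a * c))"
    using positive_eigenvalue by (simp add: weight_def card_image)
qed

lemma is_the_positive_H_eigenvalue_copy:
  assumes "switching_equivalent_to_copy D X"
  shows "is_the_positive_H_eigenvalue D \<rho> \<longleftrightarrow> is_the_positive_H_eigenvalue X \<rho>"
  using switching_equivalent_to_copy_invariants(2)[OF assms]
  by (simp add: is_the_positive_H_eigenvalue_def)

lemma is_the_positive_H_eigenvalue_unique:
  "is_the_positive_H_eigenvalue D \<rho> \<Longrightarrow> is_the_positive_H_eigenvalue D \<mu> \<Longrightarrow> \<mu> = \<rho>"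
  by (auto simp: is_the_positive_H_eigenvalue_def)

lemma rank_2_copy:
  fixes D :: "'a mgraph"
  assumes "mixed_graph D" "H_rank D = 2"
  shows "(\<exists>a b t. 1 \<le> a \<and> a \<le> b \<and>
      switching_equivalent_to_copy D (add_isolated (complete_bipartite a b) t)) \<or>
    (\<exists>a b c t. 1 \<le> a \<and> a \<le> b \<and> b \<le> c \<and>
      switching_equivalent_to_copy D (add_isolated (C3 a b c) t))"
  using assms
proof (cases rule: rank_2_classification)
  case (1 D' A B)
  interpret tri_blowup D' A B "{}" 1 1 \<i> by (rule 1)
  \<comment> \<open>The number of isolated vertices. The truncated subtraction is exact because the
    classes lie in the vertex set.\<close>
  define t where "t = card (verts D') - card (A \<union> B)"
  have a: "1 \<le> card A"
    using ne fin by (simp add: Suc_le_eq card_gt_0_iff)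
  have "card (A \<union> B) \<le> card (verts D')"
    using sub fin by (simp add: card_mono)
  moreover have "card (A \<union> B) = card A + card B"
    using fin disj by (simp add: card_Un_disjoint)
  ultimately have "card (verts D') = order (add_isolated (complete_bipartite (card A) (card B)) t)"
    using complete_bipartite_isolated(3)[OF a 1(4)] by (simp add: t_def)
  then have "mgraph_iso D' (add_isolated (complete_bipartite (card A) (card B)) t)"
    by (intro mgraph_iso[OF complete_bipartite_isolated(6)[OF a 1(4)]])
      (simp_all add: card_image order_def)
  then show ?thesis
    using 1 a unfolding switching_equivalent_to_copy_def by blast
next
  case (2 D' A B C)
  interpret tri_blowup D' A B C \<i> \<i> \<i> by (rule 2)
  define t where "t = card (verts D') - card (A \<union> B \<union> C)"
  have a: "1 \<le> card A"
    using ne fin by (simp add: Suc_le_eq card_gt_0_iff)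
  have "card (A \<union> B \<union> C) \<le> card (verts D')"
    using sub fin by (simp add: card_mono)
  moreover have "card (A \<union> B \<union> C) = card A + card B + card C"
    using fin disj by (simp add: card_Un_disjoint Int_Un_distrib2)
  ultimately have "card (verts D') = order (add_isolated (C3 (card A) (card B) (card C)) t)"
    using C3_isolated(3)[OF a 2(5,6)] by (simp add: t_def)
  then have "mgraph_iso D' (add_isolated (C3 (card A) (card B) (card C)) t)"
    by (intro mgraph_iso[OF C3_isolated(6)[OF a 2(5,6)]])
      (simp_all add: card_image order_def)
  then show ?thesis
    using 2 a unfolding switching_equivalent_to_copy_def by blast
qed

theorem theorem5p8:
  fixes D :: "'a mgraph"
  shows
    "(mixed_graph D \<and> H_rank D = 2 \<longrightarrow>
       (\<exists>\<rho>. is_the_positive_H_eigenvalue D \<rho> \<and>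
         (let former = (\<lambda>a b t. 1 \<le> a \<and> a \<le> b \<and>
                switching_equivalent_to_copy D (add_isolated (complete_bipartite a b) t));
              latter = (\<lambda>a b c t. 1 \<le> a \<and> a \<le> b \<and> b \<le> c \<and>
                switching_equivalent_to_copy D (add_isolated (C3 a b c) t))
          in ((\<exists>a b t. former a b t) \<or> (\<exists>a b c t. latter a b c t)) \<and>
             \<not> ((\<exists>a b t. former a b t) \<and> (\<exists>a b c t. latter a b c t)) \<and>
             (\<forall>a b t. former a b t \<longrightarrow>
                order D = a + b + t \<and> \<rho>\<^sup>2 = real (a * b)) \<and>
             (\<forall>a b c t. latter a b c t \<longrightarrow>
                order D = a + b + c + t \<and> \<rho>\<^sup>2 = real (a * b + b * c + a * c))))) \<and>
     (\<forall>a b t. 1 \<le> a \<and> a \<le> b \<longrightarrow>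
        (let X = add_isolated (complete_bipartite a b) t
         in mixed_graph X \<and> H_rank X = 2 \<and> order X = a + b + t \<and>
            (\<exists>\<rho>. is_the_positive_H_eigenvalue X \<rho> \<and> \<rho>\<^sup>2 = real (a * b)))) \<and>
     (\<forall>a b c t. 1 \<le> a \<and> a \<le> b \<and> b \<le> c \<longrightarrow>
        (let X = add_isolated (C3 a b c) t
         in mixed_graph X \<and> H_rank X = 2 \<and> order X = a + b + c + t \<and>
            (\<exists>\<rho>. is_the_positive_H_eigenvalue X \<rho> \<and>
                 \<rho>\<^sup>2 = real (a * b + b * c + a * c))))"
proof -
  define former where "former a b t \<longleftrightarrow> 1 \<le> a \<and> a \<le> b \<and>
    switching_equivalent_to_copy D (add_isolated (complete_bipartite a b) t)" for a b t
  define latter where "latter a b c t \<longleftrightarrow> 1 \<le> a \<and> a \<le> b \<and> b \<le> c \<and>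
    switching_equivalent_to_copy D (add_isolated (C3 a b c) t)" for a b c t
  \<comment> \<open>The facts labelled \<open>F\<close> and \<open>L\<close> hold for arbitrary
    parameters. Their opposite answers on triangles make the two cases exclusive.\<close>
  have F: "order D = a + b + t" "\<not> has_triangle D" "is_the_positive_H_eigenvalue D (sqrt (a * b))"
    if "former a b t" for a b t
    using that complete_bipartite_isolated[of a b t] unfolding former_def
    by (auto simp: switching_equivalent_to_copy_invariants is_the_positive_H_eigenvalue_copy)
  have L: "order D = a + b + c + t" "has_triangle D"
    "is_the_positive_H_eigenvalue D (sqrt (a * b + b * c + a * c))" if "latter a b c t" for a b c t
    using that C3_isolated[of a b c t] unfolding latter_def
    by (auto simp: switching_equivalent_to_copy_invariants is_the_positive_H_eigenvalue_copy)
  have K: "mixed_graph X \<and> H_rank X = 2 \<and> order X = a + b + t \<and>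
      (\<exists>\<rho>. is_the_positive_H_eigenvalue X \<rho> \<and> \<rho>\<^sup>2 = real (a * b))"
    if "1 \<le> a \<and> a \<le> b" "X = add_isolated (complete_bipartite a b) t" for a b t X
    using that complete_bipartite_isolated(1-4)[of a b t]
    by (auto intro!: exI[of _ "sqrt (a * b)"])
  have C: "mixed_graph X \<and> H_rank X = 2 \<and> order X = a + b + c + t \<and>
      (\<exists>\<rho>. is_the_positive_H_eigenvalue X \<rho> \<and> \<rho>\<^sup>2 = real (a * b + b * c + a * c))"
    if "1 \<le> a \<and> a \<le> b \<and> b \<le> c" "X = add_isolated (C3 a b c) t" for a b c t X
    using that C3_isolated(1-4)[of a b c t]
    by (auto intro!: exI[of _ "sqrt (a * b + b * c + a * c)"])
  show ?thesis
    unfolding Let_def former_def[symmetric] latter_def[symmetric]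
  proof (intro conjI[OF impI conjI])
    assume rank: "mixed_graph D \<and> H_rank D = 2"
    show "\<exists>\<rho>. is_the_positive_H_eigenvalue D \<rho> \<and>
      ((\<exists>a b t. former a b t) \<or> (\<exists>a b c t. latter a b c t)) \<and>
      \<not> ((\<exists>a b t. former a b t) \<and> (\<exists>a b c t. latter a b c t)) \<and>
      (\<forall>a b t. former a b t \<longrightarrow> order D = a + b + t \<and> \<rho>\<^sup>2 = real (a * b)) \<and>
      (\<forall>a b c t. latter a b c t \<longrightarrow>
        order D = a + b + c + t \<and> \<rho>\<^sup>2 = real (a * b + b * c + a * c))"
    proof -
      have ex: "(\<exists>a b t. former a b t) \<or> (\<exists>a b c t. latter a b c t)"
        using rank_2_copy[of D] rank by (simp add: former_def latter_def)
      \<comment> \<open>One model yields the positive eigenvalue. Its uniqueness then forces the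
        formula for every other admissible choice of parameters.\<close>
      then obtain \<rho> where \<rho>: "is_the_positive_H_eigenvalue D \<rho>"
        using F(3) L(3) by blast
      have "\<rho>\<^sup>2 = real (a * b)" if "former a b t" for a b t
        using is_the_positive_H_eigenvalue_unique[OF F(3)[OF that] \<rho>] by simp
      moreover have "\<rho>\<^sup>2 = real (a * b + b * c + a * c)" if "latter a b c t" for a b c t
        using is_the_positive_H_eigenvalue_unique[OF L(3)[OF that] \<rho>] by simp
      moreover have "\<not> ((\<exists>a b t. former a b t) \<and> (\<exists>a b c t. latter a b c t))"
        using F(2) L(2) by blast
      ultimately show ?thesis
        using \<rho> ex F(1) L(1) by (intro exI[of _ \<rho>] conjI allI impI) blast+
    qed
  qed (intro allI impI; rule K[OF _ refl] C[OF _ refl]; assumption)+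
qed

end
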